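(* A Tychonoff space $X$ is Ascoli if, and only if, for every compact (Hausdorff) space $K$, each separately continuous $k$-continuous function $\Phi:X\times K\to \mathbb{R}$ is continuous.
   Context: All spaces are assumed to be Tychonoff. $C_k(X)$ denotes the space $C(X)$ of all continuous real-valued functions on $X$ with the compact-open topology. A Tychonoff space $X$ is an Ascoli space if every compact subset $\mathcal{K}$ of $C_k(X)$ is evenly continuous, i.e. the map $X\times\mathcal{K}\ni(x,f)\mapsto f(x)\in\mathbb{R}$ is continuous; equivalently, every compact subset of $C_k(X)$ is equicontinuous. A subset $H\subseteq C(X)$ is equicontinuous if for every $x\in X$ and each $\varepsilon>0$ there is an open neighborhood $U$ of $x$ such that $|f(x')-f(x)|<\varepsilon$ for all $x'\in U$ and $f\in H$. A function $f:Z\to\mathbb{R}$ on a space $Z$ is $k$-continuous if its restriction to every compact subset of $Z$ is continuous. A function $\Phi:X\times K\to\mathbb{R}$ is separately continuous if $\Phi(x,\cdot)$ is continuous on $K$ for every $x\in X$ and $\Phi(\cdot,t)$ is continuous on $X$ for every $t\in K$. *)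

theory Defs
  imports "HOL-Analysis.Analysis"
begin

definition tychonoff_space :: "'a topology \<Rightarrow> bool" where
  "tychonoff_space X \<longleftrightarrow> completely_regular_space X \<and> Hausdorff_space X"

(* A continuous function on the space X is a function on topspace X only; the
   representing HOL function is normalised to be undefined elsewhere, so that
   equality in this set is equality on topspace X. *)
definition real_continuous_functions :: "'a topology \<Rightarrow> ('a \<Rightarrow> real) set" where
  "real_continuous_functions X =
     {f \<in> extensional (topspace X). continuous_map X euclideanreal f}"

(* C_k(X), generated by the sets [C; U] = {f. f ` C \<subseteq> U} with C compact in X and U open.
   The whole of C(X) is the member [{}; U] of this subbase. *)
definition compact_open_topology :: "'a topology \<Rightarrow> ('a \<Rightarrow> real) topology" where
  "compact_open_topology X =
     topology_generated_by
       {{f \<in> real_continuous_functions X. f ` C \<subseteq> U} | C U. compactin X C \<and> open U}"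

lemma topspace_compact_open_topology [simp]:
  "topspace (compact_open_topology X) = real_continuous_functions X"
proof -
  have "real_continuous_functions X \<in>
      {{f \<in> real_continuous_functions X. f ` C \<subseteq> U} | C U. compactin X C \<and> open U}"
    by (intro CollectI exI[of _ "{}"]) auto
  then show ?thesis
    by (auto simp: compact_open_topology_def)
qed

definition evenly_continuous :: "'a topology \<Rightarrow> ('a \<Rightarrow> real) set \<Rightarrow> bool" where
  "evenly_continuous X \<K> \<longleftrightarrow>
     continuous_map (prod_topology X (subtopology (compact_open_topology X) \<K>)) euclideanreal
       (\<lambda>(x, f). f x)"

definition ascoli_space :: "'a topology \<Rightarrow> bool" where
  "ascoli_space X \<longleftrightarrow>
     (\<forall>\<K>. compactin (compact_open_topology X) \<K> \<longrightarrow> evenly_continuous X \<K>)"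

definition k_continuous_map :: "'a topology \<Rightarrow> ('a \<Rightarrow> real) \<Rightarrow> bool" where
  "k_continuous_map Z f \<longleftrightarrow>
     (\<forall>C. compactin Z C \<longrightarrow> continuous_map (subtopology Z C) euclideanreal f)"

definition separately_continuous_map ::
    "'a topology \<Rightarrow> 'b topology \<Rightarrow> ('a \<times> 'b \<Rightarrow> real) \<Rightarrow> bool" where
  "separately_continuous_map X K \<Phi> \<longleftrightarrow>
     (\<forall>x \<in> topspace X. continuous_map K euclideanreal (\<lambda>t. \<Phi> (x, t))) \<and>
     (\<forall>t \<in> topspace K. continuous_map X euclideanreal (\<lambda>x. \<Phi> (x, t)))"

end

theory Submission
  imports Defs
begin

text \<open>
  A separately continuous, k-continuous function on \<open>X \<times> K\<close> is the same thing as a continuous map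
  \<open>K \<rightarrow> C\<^sub>k(X)\<close>: k-continuity makes it uniform on the compact sets \<open>C \<times> K\<close>, and conversely evaluation
  is always continuous on \<open>C \<times> C\<^sub>k(X)\<close> for compact Hausdorff \<open>C\<close>.  For \<open>X\<close> Ascoli, evaluation on the compact
  image of \<open>K\<close> in \<open>C\<^sub>k(X)\<close> is jointly continuous, hence so is the function on \<open>X \<times> K\<close>.
  For the converse, apply the hypothesis to the evaluation map with \<open>K\<close> a compact subset of \<open>C\<^sub>k(X)\<close>.
\<close>

lemma openin_compact_open_subbasic:
  assumes "compactin X C" "open U"
  shows "openin (compact_open_topology X) {f \<in> real_continuous_functions X. f ` C \<subseteq> U}"
  unfolding compact_open_topology_def using assms
  by (intro topology_generated_by_Basis) blast

text \<open>The preimage of \<open>U\<close> under evaluation at \<open>x\<close> is the subbasic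
  set of the compact set \<open>{x}\<close> and \<open>U\<close>.\<close>

lemma continuous_map_eval_at:
  assumes "x \<in> topspace X"
  shows "continuous_map (compact_open_topology X) euclideanreal (\<lambda>f. f x)"
  unfolding continuous_map
proof (intro conjI allI impI)
  fix U :: "real set" assume "openin euclideanreal U"
  then have "openin (compact_open_topology X) {f \<in> real_continuous_functions X. f ` {x} \<subseteq> U}"
    using assms by (intro openin_compact_open_subbasic) auto
  then show "openin (compact_open_topology X) {f \<in> topspace (compact_open_topology X). f x \<in> U}"
    by simp
qed auto

lemma Hausdorff_space_compact_open_topology: "Hausdorff_space (compact_open_topology X)"
  unfolding Hausdorff_space_def
proof (intro allI impI, elim conjE)
  fix f g
  assume f: "f \<in> topspace (compact_open_topology X)" and g: "g \<in> topspace (compact_open_topology X)"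
    and "f \<noteq> g"
  \<comment> \<open>Both functions are extensional, so they cannot differ only outside
    \<open>topspace X\<close>.\<close>
  then obtain x where x: "x \<in> topspace X" "f x \<noteq> g x"
    by (auto simp: real_continuous_functions_def intro: extensionalityI)
  then obtain U V where UV: "open U" "open V" "f x \<in> U" "g x \<in> V" "U \<inter> V = {}"
    by (meson hausdorff)
  let ?P = "\<lambda>W. {h \<in> topspace (compact_open_topology X). h x \<in> W}"
  have "openin (compact_open_topology X) (?P U)" "openin (compact_open_topology X) (?P V)"
    using openin_continuous_map_preimage[OF continuous_map_eval_at[OF x(1)]] UV by auto
  moreover have "f \<in> ?P U" "g \<in> ?P V" "disjnt (?P U) (?P V)"
    using f g UV by (auto simp: disjnt_iff)
  ultimately show "\<exists>U V. openin (compact_open_topology X) U \<and> openin (compact_open_topology X) V \<and>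
      f \<in> U \<and> g \<in> V \<and> disjnt U V"
    by blast
qed

text \<open>A compact Hausdorff \<open>C\<close> is regular, so inside \<open>C\<close> every point
  has small closed, hence compact, neighbourhoods; these supply the subbasic sets of functions
  needed for joint continuity.\<close>

lemma continuous_map_eval_compact:
  assumes "Hausdorff_space X" "compactin X C"
  shows "continuous_map (prod_topology (subtopology X C) (compact_open_topology X)) euclideanreal
           (\<lambda>(x, f). f x)"
  unfolding continuous_map
proof (intro conjI allI impI)
  let ?P = "prod_topology (subtopology X C) (compact_open_topology X)"
  fix U :: "real set" assume "openin euclideanreal U"
  then have U: "open U" by simp
  have compact_C: "compact_space (subtopology X C)"
    using assms(2) compactin_subspace by blast
  then have regular_C: "regular_space (subtopology X C)"
    using assms(1) by (simp add: Hausdorff_space_subtopology compact_Hausdorff_imp_regular_space)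
  show "openin ?P {z \<in> topspace ?P. (case z of (x, f) \<Rightarrow> f x) \<in> U}"
    unfolding openin_prod_topology_alt
  proof (intro allI impI)
    fix x f
    assume "(x, f) \<in> {z \<in> topspace ?P. (case z of (x, f) \<Rightarrow> f x) \<in> U}"
    then have x: "x \<in> topspace (subtopology X C)" and f: "f \<in> real_continuous_functions X"
      and fx: "f x \<in> U"
      by auto
    have "continuous_map (subtopology X C) euclideanreal f"
      using f by (simp add: real_continuous_functions_def continuous_map_from_subtopology)
    then have "openin (subtopology X C) {y \<in> topspace (subtopology X C). f y \<in> U}"
      using U openin_continuous_map_preimage by fastforce
    with x fx regular_C obtain V N where V: "openin (subtopology X C) V" "x \<in> V" "V \<subseteq> N"
      and N: "closedin (subtopology X C) N" "N \<subseteq> {y \<in> topspace (subtopology X C). f y \<in> U}"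
      unfolding neighbourhood_base_of_closedin[symmetric] neighbourhood_base_of
      by (metis (no_types, lifting) mem_Collect_eq)
    have "compactin X N"
      using closedin_compact_space[OF compact_C N(1)] compactin_subtopology by blast
    then have "openin (compact_open_topology X) {g \<in> real_continuous_functions X. g ` N \<subseteq> U}"
      using U by (rule openin_compact_open_subbasic)
    moreover have "f \<in> {g \<in> real_continuous_functions X. g ` N \<subseteq> U}"
      using f N by auto
    \<comment> \<open>\<open>V\<close> lies in \<open>N\<close>, and every \<open>g\<close> in the
      second factor maps \<open>N\<close> into \<open>U\<close>.\<close>
    moreover have "V \<times> {g \<in> real_continuous_functions X. g ` N \<subseteq> U}
        \<subseteq> {z \<in> topspace ?P. (case z of (x, f) \<Rightarrow> f x) \<in> U}"
      using V openin_subset[OF V(1)] by fastforce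
    ultimately show "\<exists>V W. openin (subtopology X C) V \<and> openin (compact_open_topology X) W \<and>
        x \<in> V \<and> f \<in> W \<and> V \<times> W \<subseteq> {z \<in> topspace ?P. (case z of (x, f) \<Rightarrow> f x) \<in> U}"
      using V by blast
  qed
qed auto

text \<open>A compact \<open>D\<close> lies over its first projection, which is compact in
  \<open>X\<close>, so continuity on \<open>D\<close> is inherited from
  \<open>continuous_map_eval_compact\<close>.\<close>

lemma k_continuous_map_eval:
  assumes "Hausdorff_space X"
  shows "k_continuous_map (prod_topology X (subtopology (compact_open_topology X) \<K>)) (\<lambda>(x, f). f x)"
  unfolding k_continuous_map_def
proof (intro allI impI)
  let ?K = "subtopology (compact_open_topology X) \<K>"
  fix D assume D: "compactin (prod_topology X ?K) D"
  have "compactin X (fst ` D)"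
    using D continuous_map_fst by (rule image_compactin)
  then have "continuous_map (prod_topology (subtopology X (fst ` D)) (compact_open_topology X))
      euclideanreal (\<lambda>(x, f). f x)"
    by (rule continuous_map_eval_compact[OF assms])
  then have "continuous_map (subtopology (prod_topology X (compact_open_topology X))
      (fst ` D \<times> UNIV)) euclideanreal (\<lambda>(x, f). f x)"
    by (metis subtopology_Times subtopology_UNIV)
  moreover have "D \<subseteq> fst ` D \<times> UNIV"
    by force
  ultimately have "continuous_map (subtopology (prod_topology X (compact_open_topology X)) D)
      euclideanreal (\<lambda>(x, f). f x)"
    by (rule continuous_map_from_subtopology_mono)
  \<comment> \<open>Second coordinates of points of \<open>D\<close> already lie in
    \<open>\<K>\<close>, so cutting down to \<open>\<K>\<close> first changes nothing.\<close>
  moreover have "subtopology (prod_topology X ?K) D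
      = subtopology (prod_topology X (compact_open_topology X)) D"
  proof -
    have "prod_topology X ?K = subtopology (prod_topology X (compact_open_topology X)) (UNIV \<times> \<K>)"
      by (metis subtopology_Times subtopology_UNIV)
    moreover have "D \<subseteq> UNIV \<times> \<K>"
      using compactin_subset_topspace[OF D] by auto
    ultimately show ?thesis
      by (simp add: subtopology_subtopology Int_absorb1)
  qed
  ultimately show "continuous_map (subtopology (prod_topology X ?K) D) euclideanreal (\<lambda>(x, f). f x)"
    by simp
qed

lemma separately_continuous_map_eval:
  "separately_continuous_map X (subtopology (compact_open_topology X) \<K>) (\<lambda>(x, f). f x)"
  unfolding separately_continuous_map_def
  by (auto simp: real_continuous_functions_def
      intro: continuous_map_from_subtopology continuous_map_eval_at)

text \<open>This is a tube lemma argument: k-continuity makes \<open>\<Phi>\<close> jointly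
  continuous on the compact set \<open>C \<times> topspace K\<close>, and projecting along the
  compact factor \<open>C\<close> is a closed map.\<close>

lemma continuous_map_curry_compact_open:
  fixes \<Phi> :: "'a \<times> 'b \<Rightarrow> real"
  assumes "compact_space K" "separately_continuous_map X K \<Phi>"
    and "k_continuous_map (prod_topology X K) \<Phi>"
  shows "continuous_map K (compact_open_topology X) (\<lambda>t. restrict (\<lambda>x. \<Phi> (x, t)) (topspace X))"
    (is "continuous_map K _ ?F")
proof -
  have F: "?F t \<in> real_continuous_functions X" if "t \<in> topspace K" for t
    using that assms(2)
    by (auto simp: real_continuous_functions_def separately_continuous_map_def
        intro: continuous_map_eq)
  have "openin K (?F -` {f \<in> real_continuous_functions X. f ` C \<subseteq> U} \<inter> topspace K)"
    if C: "compactin X C" and U: "open U" for C U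
  proof -
    let ?S = "subtopology (prod_topology X K) (C \<times> topspace K)"
    have S: "?S = prod_topology (subtopology X C) K"
      by (metis subtopology_Times subtopology_topspace)
    have "compactin (prod_topology X K) (C \<times> topspace K)"
      using C assms(1) by (simp add: compactin_Times compact_space_def)
    then have "continuous_map ?S euclideanreal \<Phi>"
      using assms(3) by (simp add: k_continuous_map_def)
    then have "closedin ?S {z \<in> topspace ?S. \<Phi> z \<in> - U}"
      using U by (intro closedin_continuous_map_preimage) auto
    moreover have "closed_map (prod_topology (subtopology X C) K) K snd"
      using C compactin_subspace by (blast intro: closed_map_snd)
    ultimately have "closedin K (snd ` {z \<in> topspace ?S. \<Phi> z \<in> - U})"
      unfolding S closed_map_def by blast
    then have "openin K (topspace K - snd ` {z \<in> topspace ?S. \<Phi> z \<in> - U})"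
      by blast
    \<comment> \<open>The projection collects exactly those \<open>t\<close> for which
      \<open>\<Phi> (x, t)\<close> leaves \<open>U\<close> at some \<open>x\<close> in
      \<open>C\<close>.\<close>
    moreover have "topspace K - snd ` {z \<in> topspace ?S. \<Phi> z \<in> - U}
        = ?F -` {f \<in> real_continuous_functions X. f ` C \<subseteq> U} \<inter> topspace K"
      using F compactin_subset_topspace[OF C] by (force simp: image_iff)
    ultimately show ?thesis by simp
  qed
  moreover have "?F ` topspace K
      \<subseteq> \<Union> {{f \<in> real_continuous_functions X. f ` C \<subseteq> U} | C U. compactin X C \<and> open U}"
  proof -
    have "topspace (compact_open_topology X)
        = \<Union> {{f \<in> real_continuous_functions X. f ` C \<subseteq> U} | C U. compactin X C \<and> open U}"
      unfolding compact_open_topology_def by (rule topology_generated_by_topspace)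
    then show ?thesis using F by auto
  qed
  ultimately show ?thesis
    unfolding compact_open_topology_def
    by (intro continuous_on_generated_topo) auto
qed

lemma ascoli_imp_continuous_map:
  fixes \<Phi> :: "'a \<times> 'b \<Rightarrow> real"
  assumes "ascoli_space X" "compact_space K" "separately_continuous_map X K \<Phi>"
    and "k_continuous_map (prod_topology X K) \<Phi>"
  shows "continuous_map (prod_topology X K) euclideanreal \<Phi>"
proof -
  define F where "F = (\<lambda>t. restrict (\<lambda>x. \<Phi> (x, t)) (topspace X))"
  let ?\<K> = "F ` topspace K"
  have F: "continuous_map K (compact_open_topology X) F"
    unfolding F_def using assms(2-4) by (rule continuous_map_curry_compact_open)
  then have "compactin (compact_open_topology X) ?\<K>"
    using assms(2) image_compactin unfolding compact_space_def by blast
  then have ev: "continuous_map (prod_topology X (subtopology (compact_open_topology X) ?\<K>))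
      euclideanreal (\<lambda>(x, f). f x)"
    using assms(1) by (simp add: ascoli_space_def evenly_continuous_def)
  have "continuous_map K (subtopology (compact_open_topology X) ?\<K>) F"
    using F by (auto simp: continuous_map_in_subtopology)
  then have "continuous_map (prod_topology X K)
      (prod_topology X (subtopology (compact_open_topology X) ?\<K>)) (\<lambda>z. (fst z, F (snd z)))"
    by (intro continuous_map_pairedI continuous_map_fst)
       (auto intro: continuous_map_compose[OF continuous_map_snd, unfolded comp_def])
  from continuous_map_compose[OF this ev]
  \<comment> \<open>Evaluation at \<open>(x, F t)\<close> returns \<open>\<Phi> (x, t)\<close> only
    for \<open>x\<close> in \<open>topspace X\<close>, because \<open>F t\<close> is restricted;
    agreement on the topspace of the product suffices.\<close>
  show ?thesis
    by (rule continuous_map_eq) (auto simp: F_def)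
qed

text \<open>The only test spaces required are compact subspaces of
  \<open>compact_open_topology X\<close>, whose points have type
  \<open>'a \<Rightarrow> real\<close>; this fixes the type of \<open>K\<close>.\<close>

lemma ascoli_space_if_continuous_maps:
  fixes X :: "'a topology"
  assumes "Hausdorff_space X"
    and "\<And>(K :: ('a \<Rightarrow> real) topology) \<Phi>.
      \<lbrakk>compact_space K; Hausdorff_space K; separately_continuous_map X K \<Phi>;
        k_continuous_map (prod_topology X K) \<Phi>\<rbrakk>
      \<Longrightarrow> continuous_map (prod_topology X K) euclideanreal \<Phi>"
  shows "ascoli_space X"
  unfolding ascoli_space_def evenly_continuous_def
\<comment> \<open>Even continuity of \<open>\<K>\<close> is the conclusion of
  \<open>assms(2)\<close> with \<open>K\<close> the subspace on \<open>\<K>\<close> and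
  \<open>\<Phi>\<close> the evaluation map, so only its four premises remain.\<close>
proof (intro allI impI assms(2))
  fix \<K> assume "compactin (compact_open_topology X) \<K>"
  then show "compact_space (subtopology (compact_open_topology X) \<K>)"
    by (simp add: compactin_subspace)
qed (use assms(1) in \<open>simp_all add: Hausdorff_space_subtopology
      Hausdorff_space_compact_open_topology separately_continuous_map_eval k_continuous_map_eval\<close>)

(* HOL cannot quantify over the carrier type of K inside a formula.  The forward
   implication is stated for K over an arbitrary type 'b (second conjunct); for the
   backward one it is enough to test spaces K over the type 'a => real, which is a
   weaker hypothesis than testing all K. *)
theorem theorem3p1:
  fixes X :: "'a topology"
  assumes "tychonoff_space X"
  shows "(ascoli_space X \<longleftrightarrow>
           (\<forall>(K :: ('a \<Rightarrow> real) topology) \<Phi>.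
              compact_space K \<and> Hausdorff_space K \<and>
              separately_continuous_map X K \<Phi> \<and> k_continuous_map (prod_topology X K) \<Phi>
              \<longrightarrow> continuous_map (prod_topology X K) euclideanreal \<Phi>)) \<and>
         (ascoli_space X \<longrightarrow>
           (\<forall>(K :: 'b topology) \<Phi>.
              compact_space K \<and> Hausdorff_space K \<and>
              separately_continuous_map X K \<Phi> \<and> k_continuous_map (prod_topology X K) \<Phi>
              \<longrightarrow> continuous_map (prod_topology X K) euclideanreal \<Phi>))"
proof -
  have "Hausdorff_space X"
    using assms by (simp add: tychonoff_space_def)
  then show ?thesis
    by (intro conjI iffI allI impI ascoli_space_if_continuous_maps; (elim conjE)?)
       (simp_all add: ascoli_imp_continuous_map)
qed

end
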